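(* Let $X$ be a real Banach space and $Y$ a closed subspace of $X$. The following are equivalent: (a) $Y$ has property-$(wU)$ in $X$. (b) For every proximinal closed subspace $Z\subseteq Y$, the subspace $Y/Z$ has property-$(wU)$ in $X/Z$. (c) For every $x^*\in X^*$ such that $x^*(y)=\|x^*\|$ for some $y\in S_Y$, one has $P_{Y^\perp}(x^* )=\{0\}$.
   Context: For a closed subspace $Y$ of $X$ and $y^*\in Y^*$, a norm-preserving (Hahn--Banach) extension of $y^*$ is an $x^*\in X^*$ with $x^*|_Y=y^*$ and $\|x^*\|=\|y^*\|$. $Y$ has property-$(wU)$ in $X$ if every $y^*\in Y^*$ that attains its norm on the unit sphere $S_Y$ (i.e. $\|y^*\|=y^*(y_0)$ for some $y_0\in S_Y$) has a unique norm-preserving extension to $X$. A subspace $Z$ of a normed space $W$ is proximinal if for each $w\in W$ the set $P_Z(w)=\{z\in Z:\|w-z\|=d(w,Z)\}$ is nonempty, where $d(w,Z)=\inf_{z\in Z}\|w-z\|$. $Y^\perp=\{x^*\in X^*: x^*|_Y=0\}$, and $P_{Y^\perp}(x^* )$ is the set of best approximations to $x^*$ from $Y^\perp$ in $X^*$. $Y/Z$ is regarded as a subspace of $X/Z$ with the quotient norm. *)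

theory Defs
  imports "HOL-Analysis.Analysis"
begin

text \<open>A normed space is presented generically by a carrier set V, an addition ad,
  a scalar multiplication sc and a norm N.  This lets us treat X itself and the
  quotient space X/Z (whose elements are cosets, i.e. sets) uniformly.\<close>

definition lin_on :: "'v set \<Rightarrow> ('v \<Rightarrow> 'v \<Rightarrow> 'v) \<Rightarrow> (real \<Rightarrow> 'v \<Rightarrow> 'v) \<Rightarrow> ('v \<Rightarrow> real) \<Rightarrow> bool" where
  "lin_on V ad sc f \<longleftrightarrow>
     (\<forall>u\<in>V. \<forall>v\<in>V. f (ad u v) = f u + f v) \<and> (\<forall>c. \<forall>v\<in>V. f (sc c v) = c * f v)"

definition bdd_on :: "'v set \<Rightarrow> ('v \<Rightarrow> real) \<Rightarrow> ('v \<Rightarrow> real) \<Rightarrow> bool" where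
  "bdd_on V N f \<longleftrightarrow> (\<exists>K. \<forall>v\<in>V. \<bar>f v\<bar> \<le> K * N v)"

text \<open>f is an element of the dual space of the normed space (V, ad, sc, N).\<close>
definition dual_on :: "'v set \<Rightarrow> ('v \<Rightarrow> 'v \<Rightarrow> 'v) \<Rightarrow> (real \<Rightarrow> 'v \<Rightarrow> 'v) \<Rightarrow> ('v \<Rightarrow> real) \<Rightarrow> ('v \<Rightarrow> real) \<Rightarrow> bool" where
  "dual_on V ad sc N f \<longleftrightarrow> lin_on V ad sc f \<and> bdd_on V N f"

text \<open>Dual norm of a functional on V.\<close>
definition fnorm :: "'v set \<Rightarrow> ('v \<Rightarrow> real) \<Rightarrow> ('v \<Rightarrow> real) \<Rightarrow> real" where
  "fnorm V N f = Sup ((\<lambda>v. \<bar>f v\<bar>) ` {v\<in>V. N v \<le> 1})"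

text \<open>Property-(wU) of a subspace W in the normed space V: every norm-attaining
  functional on W has a unique norm-preserving extension to V (functionals are
  compared on the carrier V only).\<close>
definition wU :: "'v set \<Rightarrow> ('v \<Rightarrow> 'v \<Rightarrow> 'v) \<Rightarrow> (real \<Rightarrow> 'v \<Rightarrow> 'v) \<Rightarrow> ('v \<Rightarrow> real) \<Rightarrow> 'v set \<Rightarrow> bool" where
  "wU V ad sc N W \<longleftrightarrow>
    (\<forall>g. dual_on W ad sc N g \<and> (\<exists>w0\<in>W. N w0 = 1 \<and> g w0 = fnorm W N g) \<longrightarrow>
       (\<exists>f. dual_on V ad sc N f \<and> (\<forall>w\<in>W. f w = g w) \<and> fnorm V N f = fnorm W N g) \<and>
       (\<forall>f1 f2. dual_on V ad sc N f1 \<and> (\<forall>w\<in>W. f1 w = g w) \<and> fnorm V N f1 = fnorm W N g \<and>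
                dual_on V ad sc N f2 \<and> (\<forall>w\<in>W. f2 w = g w) \<and> fnorm V N f2 = fnorm W N g
                \<longrightarrow> (\<forall>v\<in>V. f1 v = f2 v)))"

text \<open>Quotient space X/Z: cosets x + Z with the quotient norm.\<close>
definition coset :: "'a::real_normed_vector set \<Rightarrow> 'a \<Rightarrow> 'a set" where
  "coset Z x = (\<lambda>z. x + z) ` Z"

definition quot_carrier :: "'a::real_normed_vector set \<Rightarrow> 'a set \<Rightarrow> 'a set set" where
  "quot_carrier Z S = coset Z ` S"

definition qadd :: "'a::real_normed_vector set \<Rightarrow> 'a set \<Rightarrow> 'a set" where
  "qadd A B = {a + b | a b. a \<in> A \<and> b \<in> B}"

definition qscale :: "'a::real_normed_vector set \<Rightarrow> real \<Rightarrow> 'a set \<Rightarrow> 'a set" where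
  "qscale Z c A = {c *\<^sub>R a + z | a z. a \<in> A \<and> z \<in> Z}"

text \<open>Quotient norm of the coset A: the distance of A to 0, i.e. d(x,Z) for A = x + Z.\<close>
definition qnorm :: "'a::real_normed_vector set \<Rightarrow> real" where
  "qnorm A = infdist 0 A"

definition proximinal :: "'a::real_normed_vector set \<Rightarrow> bool" where
  "proximinal Z \<longleftrightarrow> (\<forall>x. \<exists>z\<in>Z. dist x z = infdist x Z)"

text \<open>Annihilator Y^perp in X^* and best approximations P_{Y^perp}(f) in X^*
  (with the operator norm).\<close>
definition annihilator :: "'a::real_normed_vector set \<Rightarrow> ('a \<Rightarrow> real) set" where
  "annihilator Y = {g. bounded_linear g \<and> (\<forall>y\<in>Y. g y = 0)}"

definition best_approx_dual :: "('a::real_normed_vector \<Rightarrow> real) set \<Rightarrow> ('a \<Rightarrow> real) \<Rightarrow> ('a \<Rightarrow> real) set" where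
  "best_approx_dual M f =
     {g \<in> M. onorm (\<lambda>x. f x - g x) = (INF h\<in>M. onorm (\<lambda>x. f x - h x))}"

end

theory Submission
  imports Defs
begin

text \<open>
  If x* attains its norm at y \<in> S_Y, then every h \<in> Y^perp satisfies
  ||x* - h|| \<ge> (x* - h)(y) = ||x*||, so d(x*, Y^perp) = ||x*|| and the best approximations to x*
  from Y^perp are exactly the h for which x* - h is again a norm-preserving extension of x*|_Y.
  Since by Hahn--Banach every norm-attaining functional on Y has some norm-preserving extension,
  uniqueness of these extensions is the same as P_{Y^perp}(x*) = {0}: this is (a) \<longleftrightarrow> (c).

  Functionals on X/Z are the functionals on X vanishing on Z, composed with the quotient map.
  When Z is proximinal, every coset x + Z contains an element of norm d(x, Z), so the unit ball
  of Y/Z is the image of the unit ball of Y; hence the correspondence preserves norms, and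
  norm-attainment on Y/Z yields norm-attainment on Y. Uniqueness of extensions therefore passes
  from X to X/Z, and conversely Z = {0} is proximinal with X/{0} a copy of X: (a) \<longleftrightarrow> (b).
\<close>

section \<open>Hahn--Banach extension\<close>

text \<open>Partial extensions are handled through their graphs, so that the union of a chain of them
  is again one.\<close>

locale dominated_graph =
  fixes Y :: "'a::real_vector set" and g :: "'a \<Rightarrow> real" and p :: "'a \<Rightarrow> real"
    and G :: "('a \<times> real) set"
  assumes functional: "(x, r) \<in> G \<Longrightarrow> (x, s) \<in> G \<Longrightarrow> r = s"
    and add_mem: "(x, r) \<in> G \<Longrightarrow> (y, s) \<in> G \<Longrightarrow> (x + y, r + s) \<in> G"
    and scale_mem: "(x, r) \<in> G \<Longrightarrow> (c *\<^sub>R x, c * r) \<in> G"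
    and extends: "y \<in> Y \<Longrightarrow> (y, g y) \<in> G"
    and dominated: "(x, r) \<in> G \<Longrightarrow> r \<le> p x"

lemma dominated_graph_chain_Union:
  assumes chain: "Cs \<in> chains {G. dominated_graph Y g p G}" and "Cs \<noteq> {}"
  shows "dominated_graph Y g p (\<Union>Cs)"
proof -
  have graph: "\<And>G. G \<in> Cs \<Longrightarrow> dominated_graph Y g p G"
    using chain by (auto simp: chains_def)
  have common: "\<exists>G\<in>Cs. a \<in> G \<and> b \<in> G" if ab: "a \<in> \<Union>Cs" "b \<in> \<Union>Cs" for a b
  proof -
    obtain G H where GH: "G \<in> Cs" "H \<in> Cs" "a \<in> G" "b \<in> H" using ab by blast
    moreover have "G \<subseteq> H \<or> H \<subseteq> G"
      using chain GH by (auto simp: chains_def chain_subset_def)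
    ultimately show ?thesis by blast
  qed
  show ?thesis
  proof
    fix x r s assume "(x, r) \<in> \<Union>Cs" "(x, s) \<in> \<Union>Cs"
    then obtain G where "G \<in> Cs" "(x, r) \<in> G" "(x, s) \<in> G" using common by blast
    then show "r = s" using graph dominated_graph.functional by blast
  next
    fix x r y s assume "(x, r) \<in> \<Union>Cs" "(y, s) \<in> \<Union>Cs"
    then obtain G where "G \<in> Cs" "(x, r) \<in> G" "(y, s) \<in> G" using common by blast
    then show "(x + y, r + s) \<in> \<Union>Cs" using graph dominated_graph.add_mem by blast
  next
    fix x r c assume "(x, r) \<in> \<Union>Cs"
    then show "(c *\<^sub>R x, c * r) \<in> \<Union>Cs" using graph dominated_graph.scale_mem by blast
  next
    fix y assume "y \<in> Y"
    then show "(y, g y) \<in> \<Union>Cs" using graph dominated_graph.extends \<open>Cs \<noteq> {}\<close> by blast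
  next
    fix x r assume "(x, r) \<in> \<Union>Cs"
    then show "r \<le> p x" using graph dominated_graph.dominated by blast
  qed
qed

context dominated_graph
begin

lemma zero_mem:
  assumes "Y \<noteq> {}"
  shows "(0, 0) \<in> G"
proof -
  obtain y where "y \<in> Y" using assms by blast
  then show ?thesis using scale_mem[OF extends, of y 0] by simp
qed

lemma separating_value_exists:
  assumes subadditive: "\<And>x y. p (x + y) \<le> p x + p y" and "Y \<noteq> {}"
  shows "\<exists>a. \<forall>s r. (s, r) \<in> G \<longrightarrow> r - p (s - x0) \<le> a \<and> a \<le> p (s + x0) - r"
proof -
  have separated: "r - p (s - x0) \<le> p (s' + x0) - r'"
    if "(s, r) \<in> G" "(s', r') \<in> G" for s r s' r'
  proof -
    have "r + r' \<le> p (s + s')" using that by (blast intro: dominated add_mem)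
    also have "\<dots> \<le> p (s - x0) + p (s' + x0)" using subadditive[of "s - x0" "s' + x0"] by simp
    finally show ?thesis by simp
  qed
  define L where "L = (\<lambda>(s, r). r - p (s - x0)) ` G"
  have "L \<noteq> {}" using zero_mem[OF \<open>Y \<noteq> {}\<close>] by (auto simp: L_def)
  moreover have "bdd_above L"
    using separated[OF _ zero_mem[OF \<open>Y \<noteq> {}\<close>]]
    by (auto simp: L_def bdd_above_def intro!: exI[of _ "p x0"])
  ultimately show ?thesis
    using separated by (intro exI[of _ "Sup L"]) (auto simp: L_def intro!: cSup_upper cSup_least)
qed

lemma extension_coordinates_unique:
  assumes new: "\<And>r. (x0, r) \<notin> G" and "(s1, q1) \<in> G" "(s2, q2) \<in> G"
    and eq: "s1 + t1 *\<^sub>R x0 = s2 + t2 *\<^sub>R x0"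
  shows "t1 = t2" "s1 = s2"
proof -
  have diff: "(s1 - s2, q1 - q2) \<in> G"
    using add_mem[OF assms(2) scale_mem[OF assms(3), of "-1"]] by simp
  show "t1 = t2"
  proof (rule ccontr)
    assume "t1 \<noteq> t2"
    have "s1 - s2 = (t2 - t1) *\<^sub>R x0" using eq by (simp add: algebra_simps)
    then have "(x0, (q1 - q2) / (t2 - t1)) \<in> G"
      using scale_mem[OF diff, of "1 / (t2 - t1)"] \<open>t1 \<noteq> t2\<close> by simp
    then show False using new by blast
  qed
  then show "s1 = s2" using eq by simp
qed

lemma extension_dominated:
  assumes homogeneous: "\<And>c x. c \<ge> 0 \<Longrightarrow> p (c *\<^sub>R x) = c * p x"
    and a: "\<And>s r. (s, r) \<in> G \<Longrightarrow> r - p (s - x0) \<le> a \<and> a \<le> p (s + x0) - r"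
    and "(s, q) \<in> G"
  shows "q + t * a \<le> p (s + t *\<^sub>R x0)"
proof -
  consider "t = 0" | "t > 0" | "t < 0" by linarith
  then show ?thesis
  proof cases
    case 1
    then show ?thesis using \<open>(s, q) \<in> G\<close> dominated by simp
  next
    case 2
    have "a \<le> p ((1 / t) *\<^sub>R s + x0) - (1 / t) * q" using a[OF scale_mem[OF \<open>(s, q) \<in> G\<close>]] by blast
    then have "t * a \<le> t * p ((1 / t) *\<^sub>R s + x0) - q"
      using 2 by (simp add: field_simps)
    also have "t * p ((1 / t) *\<^sub>R s + x0) = p (s + t *\<^sub>R x0)"
      using homogeneous[of t "(1 / t) *\<^sub>R s + x0"] 2 by (simp add: algebra_simps)
    finally show ?thesis by simp
  next
    case 3
    have "(1 / -t) * q - p ((1 / -t) *\<^sub>R s - x0) \<le> a" using a[OF scale_mem[OF \<open>(s, q) \<in> G\<close>]] by blast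
    then have "q - (-t) * p ((1 / -t) *\<^sub>R s - x0) \<le> (-t) * a"
      using 3 by (simp add: field_simps)
    also have "(-t) * p ((1 / -t) *\<^sub>R s - x0) = p (s + t *\<^sub>R x0)"
      using homogeneous[of "-t" "(1 / -t) *\<^sub>R s - x0"] 3 by (simp add: algebra_simps)
    finally show ?thesis by simp
  qed
qed

lemma extend_by_value:
  assumes homogeneous: "\<And>c x. c \<ge> 0 \<Longrightarrow> p (c *\<^sub>R x) = c * p x"
    and new: "\<And>r. (x0, r) \<notin> G"
    and a: "\<And>s r. (s, r) \<in> G \<Longrightarrow> r - p (s - x0) \<le> a \<and> a \<le> p (s + x0) - r"
  shows "dominated_graph Y g p {(s + t *\<^sub>R x0, r + t * a) | s r t. (s, r) \<in> G}"
    (is "dominated_graph Y g p ?G")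
proof
  fix x r1 r2 assume "(x, r1) \<in> ?G" "(x, r2) \<in> ?G"
  then obtain s1 q1 t1 s2 q2 t2 where
    1: "x = s1 + t1 *\<^sub>R x0" "r1 = q1 + t1 * a" "(s1, q1) \<in> G" and
    2: "x = s2 + t2 *\<^sub>R x0" "r2 = q2 + t2 * a" "(s2, q2) \<in> G" by blast
  have "s1 + t1 *\<^sub>R x0 = s2 + t2 *\<^sub>R x0" using 1(1) 2(1) by simp
  then have "s1 = s2" "t1 = t2" using extension_coordinates_unique[OF new 1(3) 2(3)] by blast+
  then show "r1 = r2" using 1 2 functional by blast
next
  fix x r y s assume "(x, r) \<in> ?G" "(y, s) \<in> ?G"
  then obtain s1 q1 t1 s2 q2 t2 where
    1: "x = s1 + t1 *\<^sub>R x0" "r = q1 + t1 * a" "(s1, q1) \<in> G" and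
    2: "y = s2 + t2 *\<^sub>R x0" "s = q2 + t2 * a" "(s2, q2) \<in> G" by blast
  have "x + y = (s1 + s2) + (t1 + t2) *\<^sub>R x0" "r + s = (q1 + q2) + (t1 + t2) * a"
    using 1 2 by (simp_all add: algebra_simps)
  then show "(x + y, r + s) \<in> ?G" using add_mem[OF 1(3) 2(3)] by blast
next
  fix x r c assume "(x, r) \<in> ?G"
  then obtain s q t where x: "x = s + t *\<^sub>R x0" "r = q + t * a" "(s, q) \<in> G" by blast
  have "c *\<^sub>R x = c *\<^sub>R s + (c * t) *\<^sub>R x0" "c * r = c * q + (c * t) * a"
    using x by (simp_all add: algebra_simps)
  then show "(c *\<^sub>R x, c * r) \<in> ?G" using scale_mem[OF x(3)] by blast
next
  fix y assume "y \<in> Y"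
  then show "(y, g y) \<in> ?G" using extends by force
next
  fix x r assume "(x, r) \<in> ?G"
  then show "r \<le> p x" using extension_dominated[OF homogeneous a] by blast
qed

lemma maximal_imp_total:
  assumes subadditive: "\<And>x y. p (x + y) \<le> p x + p y"
    and homogeneous: "\<And>c x. c \<ge> 0 \<Longrightarrow> p (c *\<^sub>R x) = c * p x"
    and "Y \<noteq> {}" and maximal: "\<And>G'. dominated_graph Y g p G' \<Longrightarrow> G \<subseteq> G' \<Longrightarrow> G' = G"
  shows "\<exists>r. (x, r) \<in> G"
proof (rule ccontr)
  assume "\<nexists>r. (x, r) \<in> G"
  then have new: "\<And>r. (x, r) \<notin> G" by blast
  obtain a where a: "\<And>s r. (s, r) \<in> G \<Longrightarrow> r - p (s - x) \<le> a \<and> a \<le> p (s + x) - r"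
    using separating_value_exists[OF subadditive \<open>Y \<noteq> {}\<close>] by blast
  let ?G' = "{(s + t *\<^sub>R x, r + t * a) | s r t. (s, r) \<in> G}"
  have "G \<subseteq> ?G'"
  proof
    fix u assume "u \<in> G"
    then show "u \<in> ?G'" by (intro CollectI exI[of _ "fst u"] exI[of _ "snd u"] exI[of _ 0]) simp
  qed
  moreover have "dominated_graph Y g p ?G'" using extend_by_value[OF homogeneous new a] .
  ultimately have "?G' = G" using maximal by blast
  moreover have "(x, a) \<in> ?G'"
    using zero_mem[OF \<open>Y \<noteq> {}\<close>] by (intro CollectI exI[of _ 0] exI[of _ 0] exI[of _ 1]) simp
  ultimately show False using new by simp
qed

lemma total_imp_linear_extension:
  assumes total: "\<And>x. \<exists>r. (x, r) \<in> G"
  shows "\<exists>f. linear f \<and> (\<forall>y\<in>Y. f y = g y) \<and> (\<forall>x. f x \<le> p x)"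
proof -
  define f where "f x = (THE r. (x, r) \<in> G)" for x
  have f: "(x, f x) \<in> G" for x
  proof -
    have "\<exists>!r. (x, r) \<in> G" using total functional by blast
    then show ?thesis unfolding f_def by (rule theI')
  qed
  have graph_eq: "f x = r" if "(x, r) \<in> G" for x r
    using functional[OF f that] .
  have "linear f"
  proof (rule linearI)
    show "f (x + y) = f x + f y" for x y
      using graph_eq add_mem[OF f f] by blast
    show "f (c *\<^sub>R x) = c *\<^sub>R f x" for c x
      using graph_eq scale_mem[OF f] by simp
  qed
  moreover have "\<forall>y\<in>Y. f y = g y" using graph_eq extends by blast
  moreover have "\<forall>x. f x \<le> p x" using f dominated by blast
  ultimately show ?thesis by blast
qed

end

lemma maximal_dominated_graph_exists:
  assumes Y: "subspace Y" and g: "lin_on Y (+) (*\<^sub>R) g" and g_le: "\<And>y. y \<in> Y \<Longrightarrow> g y \<le> p y"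
  shows "\<exists>M. dominated_graph Y g p M \<and> (\<forall>G. dominated_graph Y g p G \<and> M \<subseteq> G \<longrightarrow> G = M)"
proof -
  have initial: "dominated_graph Y g p ((\<lambda>y. (y, g y)) ` Y)"
    using g g_le Y by unfold_locales (auto simp: lin_on_def subspace_add subspace_scale)
  have "\<exists>U\<in>{G. dominated_graph Y g p G}. \<forall>G\<in>Cs. G \<subseteq> U"
    if Cs: "Cs \<in> chains {G. dominated_graph Y g p G}" for Cs
  proof (cases "Cs = {}")
    case True
    then show ?thesis using initial by blast
  next
    case False
    then show ?thesis using dominated_graph_chain_Union[OF Cs] by blast
  qed
  from Zorn_Lemma2[OF ballI[OF this]] show ?thesis by blast
qed

theorem hahn_banach_extension:
  fixes p :: "'a::real_vector \<Rightarrow> real"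
  assumes Y: "subspace Y" and g: "lin_on Y (+) (*\<^sub>R) g" and g_le: "\<And>y. y \<in> Y \<Longrightarrow> g y \<le> p y"
    and subadditive: "\<And>x y. p (x + y) \<le> p x + p y"
    and homogeneous: "\<And>c x. c \<ge> 0 \<Longrightarrow> p (c *\<^sub>R x) = c * p x"
  shows "\<exists>f. linear f \<and> (\<forall>y\<in>Y. f y = g y) \<and> (\<forall>x. f x \<le> p x)"
proof -
  obtain M where M: "dominated_graph Y g p M"
    and maximal: "\<And>G. dominated_graph Y g p G \<Longrightarrow> M \<subseteq> G \<Longrightarrow> G = M"
    using maximal_dominated_graph_exists[OF Y g g_le] by blast
  have "Y \<noteq> {}" using subspace_0[OF Y] by blast
  then have "\<exists>r. (x, r) \<in> M" for x
    using dominated_graph.maximal_imp_total[OF M subadditive homogeneous _ maximal] by blast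
  then show ?thesis using dominated_graph.total_imp_linear_extension[OF M] by blast
qed


section \<open>Norms of functionals\<close>

lemma lin_on_zero:
  fixes g :: "'a::real_vector \<Rightarrow> real"
  assumes "lin_on S (+) (*\<^sub>R) g" "0 \<in> S"
  shows "g 0 = 0"
proof -
  have "g (0 *\<^sub>R 0) = 0 * g 0" using assms unfolding lin_on_def by blast
  then show ?thesis by simp
qed

lemma dual_on_UNIV_iff:
  "dual_on UNIV (+) (*\<^sub>R) norm f \<longleftrightarrow> bounded_linear (f :: 'a::real_normed_vector \<Rightarrow> real)"
proof
  assume "dual_on UNIV (+) (*\<^sub>R) norm f"
  then obtain K where "\<And>u v. f (u + v) = f u + f v" "\<And>c v. f (c *\<^sub>R v) = c * f v"
    "\<And>v. \<bar>f v\<bar> \<le> K * norm v"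
    unfolding dual_on_def lin_on_def bdd_on_def by blast
  then show "bounded_linear f"
    by (intro bounded_linear_intro[where K = K]) (auto simp: mult.commute)
next
  assume "bounded_linear f"
  then obtain K where "\<And>x. norm (f x) \<le> norm x * K"
    using bounded_linear.bounded by blast
  then show "dual_on UNIV (+) (*\<^sub>R) norm f"
    using \<open>bounded_linear f\<close> unfolding dual_on_def lin_on_def bdd_on_def
    by (auto simp: linear_add linear_scale bounded_linear.linear mult.commute)
qed

lemma bounded_linear_dual_on:
  "bounded_linear f \<Longrightarrow> dual_on S (+) (*\<^sub>R) norm (f :: 'a::real_normed_vector \<Rightarrow> real)"
  using dual_on_UNIV_iff[of f] unfolding dual_on_def lin_on_def bdd_on_def by blast

lemma fnorm_cong: "(\<And>v. v \<in> S \<Longrightarrow> f v = g v) \<Longrightarrow> fnorm S N f = fnorm S N g"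
  unfolding fnorm_def by (intro arg_cong[where f = Sup] image_cong) auto

lemma fnorm_upper:
  assumes "bdd_on S norm f" "v \<in> S" "norm v \<le> 1"
  shows "\<bar>f v\<bar> \<le> fnorm S norm f"
proof -
  obtain K where K: "\<And>v. v \<in> S \<Longrightarrow> \<bar>f v\<bar> \<le> K * norm v"
    using assms(1) unfolding bdd_on_def by blast
  have "\<bar>f u\<bar> \<le> max K 0" if "u \<in> S" "norm u \<le> 1" for u
  proof -
    have "\<bar>f u\<bar> \<le> K * norm u" using K[OF that(1)] .
    also have "\<dots> \<le> max K 0 * norm u" by (simp add: mult_right_mono)
    also have "\<dots> \<le> max K 0" using that(2) by (simp add: mult_left_le)
    finally show ?thesis .
  qed
  then have "bdd_above ((\<lambda>v. \<bar>f v\<bar>) ` {v\<in>S. norm v \<le> 1})"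
    unfolding bdd_above_def by (intro exI[of _ "max K 0"]) auto
  then show ?thesis unfolding fnorm_def using assms(2,3) by (auto intro: cSUP_upper)
qed

lemma dual_on_bound:
  assumes S: "subspace S" and g: "dual_on S (+) (*\<^sub>R) norm g" and "y \<in> S"
  shows "\<bar>g y\<bar> \<le> fnorm S norm g * norm y"
proof (cases "y = 0")
  case True
  then show ?thesis using lin_on_zero S g subspace_0 unfolding dual_on_def by fastforce
next
  case False
  have "(1 / norm y) *\<^sub>R y \<in> S" using S \<open>y \<in> S\<close> by (simp add: subspace_scale)
  then have "\<bar>g ((1 / norm y) *\<^sub>R y)\<bar> \<le> fnorm S norm g"
    using g False unfolding dual_on_def by (intro fnorm_upper) auto
  moreover have "g ((1 / norm y) *\<^sub>R y) = g y / norm y"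
    using g \<open>y \<in> S\<close> unfolding dual_on_def lin_on_def by simp
  ultimately show ?thesis using False by (simp add: divide_le_eq abs_div mult.commute)
qed

lemma fnorm_nonneg:
  assumes "bdd_on S norm f" "0 \<in> S"
  shows "0 \<le> fnorm S norm f"
proof -
  have "\<bar>f 0\<bar> \<le> fnorm S norm f" using fnorm_upper[OF assms] by simp
  then show ?thesis by linarith
qed

lemma fnorm_le_onorm:
  assumes f: "bounded_linear f" and "0 \<in> S"
  shows "fnorm S norm (f :: 'a::real_normed_vector \<Rightarrow> real) \<le> onorm f"
proof -
  have "\<bar>f v\<bar> \<le> onorm f" if "norm v \<le> 1" for v
  proof -
    have "\<bar>f v\<bar> \<le> onorm f * norm v" using onorm[OF f, of v] by simp
    also have "\<dots> \<le> onorm f" using that onorm_pos_le[OF f] by (simp add: mult_left_le)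
    finally show ?thesis .
  qed
  then show ?thesis unfolding fnorm_def using \<open>0 \<in> S\<close> by (intro cSUP_least) auto
qed

lemma fnorm_UNIV:
  assumes f: "bounded_linear f"
  shows "fnorm UNIV norm (f :: 'a::real_normed_vector \<Rightarrow> real) = onorm f"
proof (rule antisym)
  show "fnorm UNIV norm f \<le> onorm f" using fnorm_le_onorm[OF f] by simp
  have dual: "dual_on UNIV (+) (*\<^sub>R) norm f" using bounded_linear_dual_on[OF f] .
  then have "0 \<le> fnorm UNIV norm f"
    using fnorm_nonneg unfolding dual_on_def by blast
  then show "onorm f \<le> fnorm UNIV norm f"
    using dual_on_bound[OF subspace_UNIV dual] by (intro onorm_bound) auto
qed

lemma fnorm_eq_onorm_if_attained:
  assumes f: "bounded_linear f" and "0 \<in> S" "y \<in> S" "norm y = 1" "f y = onorm f"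
  shows "fnorm S norm (f :: 'a::real_normed_vector \<Rightarrow> real) = onorm f"
proof (rule antisym)
  show "fnorm S norm f \<le> onorm f" using fnorm_le_onorm[OF f \<open>0 \<in> S\<close>] .
  have "bdd_on S norm f" using bounded_linear_dual_on[OF f] unfolding dual_on_def by blast
  from fnorm_upper[OF this \<open>y \<in> S\<close>] assms(4,5) show "onorm f \<le> fnorm S norm f" by simp
qed

lemma norm_preserving_extension_exists:
  fixes g :: "'a::real_normed_vector \<Rightarrow> real"
  assumes Y: "subspace Y" and g: "dual_on Y (+) (*\<^sub>R) norm g"
  shows "\<exists>f. bounded_linear f \<and> (\<forall>y\<in>Y. f y = g y) \<and> onorm f = fnorm Y norm g"
proof -
  let ?C = "fnorm Y norm g"
  have C: "0 \<le> ?C" using fnorm_nonneg g subspace_0[OF Y] unfolding dual_on_def by blast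
  have "lin_on Y (+) (*\<^sub>R) g" using g unfolding dual_on_def by blast
  moreover have "g y \<le> ?C * norm y" if "y \<in> Y" for y
    using dual_on_bound[OF Y g that] by simp
  moreover have "?C * norm (x + y) \<le> ?C * norm x + ?C * norm y" for x y
    using mult_left_mono[OF norm_triangle_ineq C] by (simp add: distrib_left)
  moreover have "?C * norm (c *\<^sub>R x) = c * (?C * norm x)" if "0 \<le> c" for c x
    using that by simp
  ultimately obtain f where f: "linear f" "\<forall>y\<in>Y. f y = g y" "\<forall>x. f x \<le> ?C * norm x"
    using hahn_banach_extension[OF Y, of g "\<lambda>x. ?C * norm x"] by blast
  have bound: "\<bar>f x\<bar> \<le> ?C * norm x" for x
    using f(3)[rule_format, of x] f(3)[rule_format, of "-x"] linear_neg[OF f(1), of x] by auto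
  have "bounded_linear f"
    using f(1) bound by (intro bounded_linear_intro[where K = ?C])
      (auto simp: linear_add linear_scale mult.commute)
  moreover have "onorm f \<le> ?C" using bound C by (intro onorm_bound) auto
  moreover have "?C \<le> onorm f"
    using fnorm_le_onorm[OF \<open>bounded_linear f\<close> subspace_0[OF Y]] fnorm_cong[of Y f g] f(2)
    by simp
  ultimately show ?thesis using f(2) by (intro exI[of _ f]) simp
qed


section \<open>Property (wU) and best approximation from the annihilator\<close>

definition norm_attaining ::
    "'v set \<Rightarrow> ('v \<Rightarrow> 'v \<Rightarrow> 'v) \<Rightarrow> (real \<Rightarrow> 'v \<Rightarrow> 'v) \<Rightarrow> ('v \<Rightarrow> real) \<Rightarrow>
      ('v \<Rightarrow> real) \<Rightarrow> bool"
  where "norm_attaining W ad sc N g \<longleftrightarrow>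
    dual_on W ad sc N g \<and> (\<exists>w\<in>W. N w = 1 \<and> g w = fnorm W N g)"

definition norm_preserving_ext ::
    "'v set \<Rightarrow> ('v \<Rightarrow> 'v \<Rightarrow> 'v) \<Rightarrow> (real \<Rightarrow> 'v \<Rightarrow> 'v) \<Rightarrow> ('v \<Rightarrow> real) \<Rightarrow> 'v set \<Rightarrow>
      ('v \<Rightarrow> real) \<Rightarrow> ('v \<Rightarrow> real) \<Rightarrow> bool"
  where "norm_preserving_ext V ad sc N W g f \<longleftrightarrow>
    dual_on V ad sc N f \<and> (\<forall>w\<in>W. f w = g w) \<and> fnorm V N f = fnorm W N g"

lemma wUI:
  assumes "\<And>g. norm_attaining W ad sc N g \<Longrightarrow> \<exists>f. norm_preserving_ext V ad sc N W g f"
    and "\<And>g f1 f2 v. norm_attaining W ad sc N g \<Longrightarrow> norm_preserving_ext V ad sc N W g f1 \<Longrightarrow>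
      norm_preserving_ext V ad sc N W g f2 \<Longrightarrow> v \<in> V \<Longrightarrow> f1 v = f2 v"
  shows "wU V ad sc N W"
  using assms unfolding wU_def norm_attaining_def norm_preserving_ext_def by blast

lemma wU_extension_exists:
  "wU V ad sc N W \<Longrightarrow> norm_attaining W ad sc N g \<Longrightarrow> \<exists>f. norm_preserving_ext V ad sc N W g f"
  unfolding wU_def norm_attaining_def norm_preserving_ext_def by blast

lemma wU_extension_unique:
  "wU V ad sc N W \<Longrightarrow> norm_attaining W ad sc N g \<Longrightarrow> norm_preserving_ext V ad sc N W g f \<Longrightarrow>
    norm_preserving_ext V ad sc N W g f' \<Longrightarrow> v \<in> V \<Longrightarrow> f v = f' v"
  unfolding wU_def norm_attaining_def norm_preserving_ext_def by blast

lemma norm_preserving_ext_UNIV_iff: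
  "norm_preserving_ext UNIV (+) (*\<^sub>R) norm Y g f \<longleftrightarrow>
     bounded_linear f \<and> (\<forall>y\<in>Y. f y = g y) \<and> onorm f = fnorm Y norm (g :: 'a::real_normed_vector \<Rightarrow> real)"
  unfolding norm_preserving_ext_def using dual_on_UNIV_iff fnorm_UNIV by metis

lemma INF_annihilator_norm_attaining:
  assumes f: "bounded_linear f" and y: "y \<in> Y" "norm y = 1" "f y = onorm f"
  shows "(INF h\<in>annihilator Y. onorm (\<lambda>x. f x - h x)) = onorm (f :: 'a::real_normed_vector \<Rightarrow> real)"
proof (rule antisym)
  have zero: "(\<lambda>x. 0) \<in> annihilator Y" unfolding annihilator_def by simp
  have lower: "onorm f \<le> onorm (\<lambda>x. f x - h x)" if "h \<in> annihilator Y" for h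
  proof -
    have h: "bounded_linear h" "h y = 0" using that y unfolding annihilator_def by auto
    have "onorm f = norm (f y - h y)" using h y onorm_pos_le[OF f] by simp
    also have "\<dots> \<le> onorm (\<lambda>x. f x - h x)"
      using onorm[OF bounded_linear_sub[OF f h(1)], of y] y by simp
    finally show ?thesis .
  qed
  have "(INF h\<in>annihilator Y. onorm (\<lambda>x. f x - h x)) \<le> onorm (\<lambda>x. f x - 0)"
    using lower by (intro cINF_lower[OF _ zero]) (auto simp: bdd_below_def)
  then show "(INF h\<in>annihilator Y. onorm (\<lambda>x. f x - h x)) \<le> onorm f" by simp
  show "onorm f \<le> (INF h\<in>annihilator Y. onorm (\<lambda>x. f x - h x))"
    using zero lower by (intro cINF_greatest) auto
qed

lemma best_approx_annihilator_iff_norm_preserving: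
  assumes Y: "subspace Y" and f: "bounded_linear f" and y: "y \<in> Y" "norm y = 1" "f y = onorm f"
    and h: "h \<in> annihilator Y"
  shows "h \<in> best_approx_dual (annihilator Y) f \<longleftrightarrow>
           norm_preserving_ext UNIV (+) (*\<^sub>R) norm Y f (\<lambda>x. f x - h x)"
proof -
  have "fnorm Y norm f = onorm f"
    using fnorm_eq_onorm_if_attained[OF f subspace_0[OF Y] y] .
  moreover have "bounded_linear (\<lambda>x. f x - h x)" "\<forall>y\<in>Y. f y - h y = f y"
    using bounded_linear_sub[OF f] h unfolding annihilator_def by auto
  ultimately show ?thesis
    using h unfolding norm_preserving_ext_UNIV_iff best_approx_dual_def
      INF_annihilator_norm_attaining[OF f y] by auto
qed

lemma best_approx_annihilator_trivial_if_wU: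
  fixes Y :: "'a::real_normed_vector set"
  assumes Y: "subspace Y" and wU: "wU UNIV (+) (*\<^sub>R) norm Y"
    and f: "bounded_linear f" and y: "y \<in> Y" "norm y = 1" "f y = onorm f"
  shows "best_approx_dual (annihilator Y) f = {\<lambda>x. 0}"
proof -
  have fY: "fnorm Y norm f = onorm f" using fnorm_eq_onorm_if_attained[OF f subspace_0[OF Y] y] .
  have "norm_attaining Y (+) (*\<^sub>R) norm f"
    using bounded_linear_dual_on[OF f] y fY unfolding norm_attaining_def by auto
  then have unique: "\<And>f1 f2. norm_preserving_ext UNIV (+) (*\<^sub>R) norm Y f f1 \<Longrightarrow>
      norm_preserving_ext UNIV (+) (*\<^sub>R) norm Y f f2 \<Longrightarrow> f1 = f2"
    using wU_extension_unique[OF wU] by blast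
  have self: "norm_preserving_ext UNIV (+) (*\<^sub>R) norm Y f f"
    using f fY unfolding norm_preserving_ext_UNIV_iff by simp
  have "h = (\<lambda>x. 0)" if "h \<in> best_approx_dual (annihilator Y) f" for h
  proof -
    have "h \<in> annihilator Y" using that unfolding best_approx_dual_def by blast
    then have "norm_preserving_ext UNIV (+) (*\<^sub>R) norm Y f (\<lambda>x. f x - h x)"
      using best_approx_annihilator_iff_norm_preserving[OF Y f y] that by blast
    from fun_cong[OF unique[OF this self]] show ?thesis by (intro ext) simp
  qed
  moreover have "(\<lambda>x. 0) \<in> best_approx_dual (annihilator Y) f"
    using best_approx_annihilator_iff_norm_preserving[OF Y f y] self
    unfolding annihilator_def by simp
  ultimately show ?thesis by blast
qed

lemma wU_if_best_approx_annihilator_trivial: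
  fixes Y :: "'a::real_normed_vector set"
  assumes Y: "subspace Y"
    and trivial: "\<And>f y. bounded_linear f \<Longrightarrow> y \<in> Y \<Longrightarrow> norm y = 1 \<Longrightarrow> f y = onorm f \<Longrightarrow>
      best_approx_dual (annihilator Y) f = {\<lambda>x. 0}"
  shows "wU UNIV (+) (*\<^sub>R) norm Y"
proof (rule wUI)
  fix g assume "norm_attaining Y (+) (*\<^sub>R) norm g"
  then show "\<exists>f. norm_preserving_ext UNIV (+) (*\<^sub>R) norm Y g f"
    using norm_preserving_extension_exists[OF Y]
    unfolding norm_preserving_ext_UNIV_iff norm_attaining_def by blast
next
  fix g f1 f2 and v :: 'a
  assume "norm_attaining Y (+) (*\<^sub>R) norm g"
  then obtain w where w: "w \<in> Y" "norm w = 1" "g w = fnorm Y norm g"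
    unfolding norm_attaining_def by blast
  assume "norm_preserving_ext UNIV (+) (*\<^sub>R) norm Y g f1"
    and "norm_preserving_ext UNIV (+) (*\<^sub>R) norm Y g f2"
  then have f1: "bounded_linear f1" "\<forall>y\<in>Y. f1 y = g y" "onorm f1 = fnorm Y norm g"
    and f2: "bounded_linear f2" "\<forall>y\<in>Y. f2 y = g y" "onorm f2 = fnorm Y norm g"
    unfolding norm_preserving_ext_UNIV_iff by auto
  have att: "f1 w = onorm f1" using f1 w by simp
  let ?h = "\<lambda>x. f1 x - f2 x"
  have h: "?h \<in> annihilator Y"
    using bounded_linear_sub[OF f1(1) f2(1)] f1(2) f2(2) unfolding annihilator_def by simp
  have "norm_preserving_ext UNIV (+) (*\<^sub>R) norm Y f1 (\<lambda>x. f1 x - ?h x)"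
    using f1 f2 fnorm_cong[of Y f1 g] unfolding norm_preserving_ext_UNIV_iff by simp
  then have "?h \<in> best_approx_dual (annihilator Y) f1"
    using best_approx_annihilator_iff_norm_preserving[OF Y f1(1) w(1,2) att h] by blast
  then have "?h = (\<lambda>x. 0)" using trivial[OF f1(1) w(1,2) att] by blast
  then show "f1 v = f2 v" using fun_cong[of ?h "\<lambda>x. 0" v] by simp
qed

lemma wU_iff_best_approx_annihilator_trivial:
  fixes Y :: "'a::real_normed_vector set"
  assumes "subspace Y"
  shows "wU UNIV (+) (*\<^sub>R) norm Y \<longleftrightarrow>
           (\<forall>f. bounded_linear f \<and> (\<exists>y\<in>Y. norm y = 1 \<and> f y = onorm f) \<longrightarrow>
              best_approx_dual (annihilator Y) f = {\<lambda>x. 0})"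
  using best_approx_annihilator_trivial_if_wU[OF assms] wU_if_best_approx_annihilator_trivial[OF assms]
  by blast


section \<open>Quotients by proximinal subspaces\<close>

context
  fixes Z :: "'a::real_normed_vector set"
  assumes Z: "subspace Z"
begin

lemma coset_eq_iff: "coset Z x = coset Z y \<longleftrightarrow> x - y \<in> Z"
proof
  assume eq: "coset Z x = coset Z y"
  have "x \<in> coset Z x" unfolding coset_def using subspace_0[OF Z] by force
  then obtain z where "z \<in> Z" "x = y + z" using eq unfolding coset_def by auto
  then show "x - y \<in> Z" by simp
next
  assume d: "x - y \<in> Z"
  show "coset Z x = coset Z y"
    unfolding coset_def
  proof (intro equalityI image_subsetI)
    fix z assume "z \<in> Z"
    then have "x - y + z \<in> Z" using d subspace_add[OF Z] by blast
    then show "x + z \<in> (\<lambda>z. y + z) ` Z" by (rule rev_image_eqI) simp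
  next
    fix z assume "z \<in> Z"
    then have "z - (x - y) \<in> Z" using d subspace_diff[OF Z] by blast
    then show "y + z \<in> (\<lambda>z. x + z) ` Z" by (rule rev_image_eqI) simp
  qed
qed

lemma qadd_coset: "qadd (coset Z x) (coset Z y) = coset Z (x + y)"
proof (intro equalityI subsetI)
  fix w assume "w \<in> qadd (coset Z x) (coset Z y)"
  then obtain z1 z2 where "z1 \<in> Z" "z2 \<in> Z" "w = (x + y) + (z1 + z2)"
    unfolding qadd_def coset_def by (auto simp: algebra_simps)
  then show "w \<in> coset Z (x + y)" unfolding coset_def using subspace_add[OF Z] by blast
next
  fix w assume "w \<in> coset Z (x + y)"
  then obtain z where "z \<in> Z" "w = (x + z) + (y + 0)" unfolding coset_def by auto
  then show "w \<in> qadd (coset Z x) (coset Z y)"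
    unfolding qadd_def coset_def using subspace_0[OF Z] by blast
qed

lemma qscale_coset: "qscale Z c (coset Z x) = coset Z (c *\<^sub>R x)"
proof (intro equalityI subsetI)
  fix w assume "w \<in> qscale Z c (coset Z x)"
  then obtain z1 z2 where "z1 \<in> Z" "z2 \<in> Z" "w = c *\<^sub>R x + (c *\<^sub>R z1 + z2)"
    unfolding qscale_def coset_def by (auto simp: algebra_simps)
  then show "w \<in> coset Z (c *\<^sub>R x)"
    unfolding coset_def using subspace_add[OF Z] subspace_scale[OF Z] by blast
next
  fix w assume "w \<in> coset Z (c *\<^sub>R x)"
  moreover have "x \<in> coset Z x" unfolding coset_def using subspace_0[OF Z] by force
  ultimately show "w \<in> qscale Z c (coset Z x)" unfolding qscale_def coset_def by blast
qed

lemma qnorm_coset: "qnorm (coset Z x) = infdist x Z"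
proof -
  have "coset Z x = (\<lambda>z. x - z) ` Z"
    unfolding coset_def using subspace_neg[OF Z]
    by (auto intro!: image_eqI[of _ _ "- z" for z] simp: image_iff)
  moreover have "Z \<noteq> {}" using subspace_0[OF Z] by blast
  ultimately show ?thesis
    unfolding qnorm_def infdist_def by (simp add: image_image dist_norm)
qed

lemma qnorm_coset_le: "qnorm (coset Z x) \<le> norm x"
  using infdist_le[OF subspace_0[OF Z], of x] by (simp add: qnorm_coset)

lemma proximinal_coset_rep:
  assumes "proximinal Z" "Z \<subseteq> S" "subspace S" "x \<in> S"
  shows "\<exists>x'\<in>S. coset Z x' = coset Z x \<and> norm x' = qnorm (coset Z x)"
proof -
  obtain z where z: "z \<in> Z" "dist x z = infdist x Z"
    using assms(1) unfolding proximinal_def by blast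
  have "x - z \<in> S" using assms(2-4) z(1) by (auto intro: subspace_diff)
  moreover have "coset Z (x - z) = coset Z x" using coset_eq_iff subspace_neg[OF Z z(1)] by simp
  moreover have "norm (x - z) = qnorm (coset Z x)" using z(2) by (simp add: qnorm_coset dist_norm)
  ultimately show ?thesis by blast
qed

lemma quotient_unit_ball:
  assumes "proximinal Z" "Z \<subseteq> S" "subspace S"
  shows "{A \<in> coset Z ` S. qnorm A \<le> 1} = coset Z ` {x \<in> S. norm x \<le> 1}"
proof (intro equalityI subsetI)
  fix A assume "A \<in> {A \<in> coset Z ` S. qnorm A \<le> 1}"
  then obtain x where "x \<in> S" "A = coset Z x" "qnorm A \<le> 1" by blast
  moreover obtain x' where "x' \<in> S" "coset Z x' = coset Z x" "norm x' = qnorm (coset Z x)"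
    using proximinal_coset_rep[OF assms \<open>x \<in> S\<close>] by blast
  ultimately show "A \<in> coset Z ` {x \<in> S. norm x \<le> 1}" by (intro image_eqI[of _ _ x']) auto
next
  fix A assume "A \<in> coset Z ` {x \<in> S. norm x \<le> 1}"
  then obtain x where "x \<in> S" "norm x \<le> 1" "A = coset Z x" by blast
  then show "A \<in> {A \<in> coset Z ` S. qnorm A \<le> 1}" using qnorm_coset_le[of x] by simp
qed

lemma lin_on_quotient_iff:
  "lin_on (coset Z ` S) qadd (qscale Z) F \<longleftrightarrow> lin_on S (+) (*\<^sub>R) (\<lambda>x. F (coset Z x))"
  unfolding lin_on_def by (auto simp: qadd_coset qscale_coset)

lemma bdd_on_quotient_iff:
  assumes "proximinal Z" "Z \<subseteq> S" "subspace S"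
  shows "bdd_on (coset Z ` S) qnorm F \<longleftrightarrow> bdd_on S norm (\<lambda>x. F (coset Z x))"
proof
  assume "bdd_on (coset Z ` S) qnorm F"
  then obtain K where K: "\<And>x. x \<in> S \<Longrightarrow> \<bar>F (coset Z x)\<bar> \<le> K * qnorm (coset Z x)"
    unfolding bdd_on_def by blast
  have "\<bar>F (coset Z x)\<bar> \<le> max K 0 * norm x" if "x \<in> S" for x
  proof -
    have "\<bar>F (coset Z x)\<bar> \<le> max K 0 * qnorm (coset Z x)"
      using K[OF that] mult_right_mono[of K "max K 0" "qnorm (coset Z x)"]
      by (simp add: qnorm_def infdist_nonneg)
    also have "\<dots> \<le> max K 0 * norm x" by (simp add: mult_left_mono qnorm_coset_le)
    finally show ?thesis .
  qed
  then show "bdd_on S norm (\<lambda>x. F (coset Z x))" unfolding bdd_on_def by blast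
next
  assume "bdd_on S norm (\<lambda>x. F (coset Z x))"
  then obtain K where K: "\<And>x. x \<in> S \<Longrightarrow> \<bar>F (coset Z x)\<bar> \<le> K * norm x"
    unfolding bdd_on_def by blast
  have "\<bar>F A\<bar> \<le> K * qnorm A" if "A \<in> coset Z ` S" for A
    using that K proximinal_coset_rep[OF assms] by force
  then show "bdd_on (coset Z ` S) qnorm F" unfolding bdd_on_def by blast
qed

lemma dual_on_quotient_iff:
  assumes "proximinal Z" "Z \<subseteq> S" "subspace S"
  shows "dual_on (coset Z ` S) qadd (qscale Z) qnorm F \<longleftrightarrow>
           dual_on S (+) (*\<^sub>R) norm (\<lambda>x. F (coset Z x))"
  unfolding dual_on_def using lin_on_quotient_iff bdd_on_quotient_iff[OF assms] by blast

lemma fnorm_quotient: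
  assumes "proximinal Z" "Z \<subseteq> S" "subspace S"
  shows "fnorm (coset Z ` S) qnorm F = fnorm S norm (\<lambda>x. F (coset Z x))"
  unfolding fnorm_def quotient_unit_ball[OF assms] image_image ..

end

definition quot_lift :: "'a::real_normed_vector set \<Rightarrow> ('a \<Rightarrow> 'b) \<Rightarrow> 'a set \<Rightarrow> 'b" where
  "quot_lift Z f A = f (SOME x. A = coset Z x)"

lemma quot_lift_coset:
  assumes "subspace Z" and "\<And>x x'. x - x' \<in> Z \<Longrightarrow> f x = f x'"
  shows "(\<lambda>x. quot_lift Z f (coset Z x)) = f"
proof
  fix y
  have "coset Z y = coset Z (SOME x. coset Z y = coset Z x)" by (rule someI[of _ y]) simp
  then show "quot_lift Z f (coset Z y) = f y"
    unfolding quot_lift_def using assms coset_eq_iff by metis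
qed

lemma norm_preserving_ext_quotient_iff:
  assumes "subspace Z" "proximinal Z" "Z \<subseteq> Y" "subspace Y"
  shows "norm_preserving_ext (coset Z ` UNIV) qadd (qscale Z) qnorm (coset Z ` Y) G F \<longleftrightarrow>
    norm_preserving_ext UNIV (+) (*\<^sub>R) norm Y (\<lambda>x. G (coset Z x)) (\<lambda>x. F (coset Z x))"
  using assms unfolding norm_preserving_ext_def
  by (simp add: dual_on_quotient_iff fnorm_quotient)

lemma norm_attaining_quotient:
  assumes Z: "subspace Z" "proximinal Z" "Z \<subseteq> Y" and Y: "subspace Y"
    and G: "norm_attaining (coset Z ` Y) qadd (qscale Z) qnorm G"
  shows "norm_attaining Y (+) (*\<^sub>R) norm (\<lambda>x. G (coset Z x))"
proof -
  obtain y where y: "y \<in> Y" "qnorm (coset Z y) = 1" "G (coset Z y) = fnorm (coset Z ` Y) qnorm G"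
    and dual: "dual_on (coset Z ` Y) qadd (qscale Z) qnorm G"
    using G unfolding norm_attaining_def by blast
  obtain y' where "y' \<in> Y" "coset Z y' = coset Z y" "norm y' = 1"
    using proximinal_coset_rep[OF Z Y y(1)] y(2) by auto
  then show ?thesis
    using dual y(3) Z Y unfolding norm_attaining_def
    by (auto simp: dual_on_quotient_iff fnorm_quotient)
qed

lemma coset_zero: "coset {0} x = {x}"
  unfolding coset_def by simp

lemma proximinal_zero: "proximinal {0::'a::real_normed_vector}"
  unfolding proximinal_def by simp

lemma quot_lift_zero_coset: "quot_lift {0} f (coset {0} x) = f x"
  using quot_lift_coset[of "{0}" f] by (simp add: fun_eq_iff)

lemma norm_attaining_quotient_zero:
  fixes Y :: "'a::real_normed_vector set"
  assumes Y: "subspace Y" and g: "norm_attaining Y (+) (*\<^sub>R) norm g"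
  shows "norm_attaining (coset {0} ` Y) qadd (qscale {0}) qnorm (quot_lift {0} g)"
proof -
  have Z: "subspace {0::'a}" "proximinal {0::'a}" "{0} \<subseteq> Y"
    using subspace_0[OF Y] proximinal_zero by auto
  obtain w where "w \<in> Y" "norm w = 1" "g w = fnorm Y norm g" "dual_on Y (+) (*\<^sub>R) norm g"
    using g unfolding norm_attaining_def by blast
  moreover have "qnorm (coset {0} w) = norm w" by (simp add: coset_zero qnorm_def)
  ultimately show ?thesis
    unfolding norm_attaining_def dual_on_quotient_iff[OF Z Y] fnorm_quotient[OF Z Y]
    by (auto simp: quot_lift_zero_coset)
qed

lemma wU_quotient:
  fixes Y :: "'a::real_normed_vector set"
  assumes Y: "subspace Y" and Z: "subspace Z" "proximinal Z" "Z \<subseteq> Y"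
    and wU: "wU UNIV (+) (*\<^sub>R) norm Y"
  shows "wU (quot_carrier Z UNIV) qadd (qscale Z) qnorm (quot_carrier Z Y)"
  unfolding quot_carrier_def
proof (rule wUI)
  fix G assume "norm_attaining (coset Z ` Y) qadd (qscale Z) qnorm G"
  then have g: "norm_attaining Y (+) (*\<^sub>R) norm (\<lambda>x. G (coset Z x))"
    using norm_attaining_quotient[OF Z Y] by blast
  then obtain f where f: "norm_preserving_ext UNIV (+) (*\<^sub>R) norm Y (\<lambda>x. G (coset Z x)) f"
    using wU_extension_exists[OF wU] by blast
  then have "bounded_linear f" "\<forall>y\<in>Y. f y = G (coset Z y)"
    unfolding norm_preserving_ext_UNIV_iff by auto
  have "G (coset Z 0) = 0"
    using lin_on_zero[of Y "\<lambda>x. G (coset Z x)"] g subspace_0[OF Y]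
    unfolding norm_attaining_def dual_on_def by blast
  then have "f x = f x'" if "x - x' \<in> Z" for x x'
  proof -
    have "f (x - x') = 0"
      using that Z(3) \<open>\<forall>y\<in>Y. f y = G (coset Z y)\<close> coset_eq_iff[OF Z(1), of "x - x'" 0]
        \<open>G (coset Z 0) = 0\<close> by auto
    then show ?thesis using linear_diff[OF bounded_linear.linear[OF \<open>bounded_linear f\<close>]] by simp
  qed
  then have lift: "(\<lambda>x. quot_lift Z f (coset Z x)) = f" using quot_lift_coset[OF Z(1)] by blast
  have "norm_preserving_ext (coset Z ` UNIV) qadd (qscale Z) qnorm (coset Z ` Y) G (quot_lift Z f)"
    unfolding norm_preserving_ext_quotient_iff[OF Z Y] lift using f .
  then show "\<exists>F. norm_preserving_ext (coset Z ` UNIV) qadd (qscale Z) qnorm (coset Z ` Y) G F"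
    by blast
next
  fix G F1 F2 and A :: "'a set"
  assume G: "norm_attaining (coset Z ` Y) qadd (qscale Z) qnorm G"
    and "norm_preserving_ext (coset Z ` UNIV) qadd (qscale Z) qnorm (coset Z ` Y) G F1"
    and "norm_preserving_ext (coset Z ` UNIV) qadd (qscale Z) qnorm (coset Z ` Y) G F2"
    and "A \<in> coset Z ` UNIV"
  then show "F1 A = F2 A"
    using wU_extension_unique[OF wU norm_attaining_quotient[OF Z Y G]]
      norm_preserving_ext_quotient_iff[OF Z Y] by blast
qed

lemma wU_of_wU_quotient_zero:
  fixes Y :: "'a::real_normed_vector set"
  assumes Y: "subspace Y"
    and wU: "wU (quot_carrier {0} UNIV) qadd (qscale {0}) qnorm (quot_carrier {0} Y)"
  shows "wU UNIV (+) (*\<^sub>R) norm Y"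
proof -
  have Z: "subspace {0::'a}" "proximinal {0::'a}" "{0} \<subseteq> Y"
    using subspace_0[OF Y] proximinal_zero by auto
  note lift_ext = norm_preserving_ext_quotient_iff[OF Z Y, of "quot_lift {0} g" for g,
      unfolded quot_lift_zero_coset]
  note wU' = wU[unfolded quot_carrier_def]
  show ?thesis
  proof (rule wUI)
    fix g assume "norm_attaining Y (+) (*\<^sub>R) norm g"
    from wU_extension_exists[OF wU' norm_attaining_quotient_zero[OF Y this]] obtain F
      where "norm_preserving_ext (coset {0} ` UNIV) qadd (qscale {0}) qnorm (coset {0} ` Y)
        (quot_lift {0} g) F"
      by blast
    then show "\<exists>f. norm_preserving_ext UNIV (+) (*\<^sub>R) norm Y g f"
      unfolding lift_ext by blast
  next
    fix g f1 f2 and v :: 'a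
    assume g: "norm_attaining Y (+) (*\<^sub>R) norm g"
      and f1: "norm_preserving_ext UNIV (+) (*\<^sub>R) norm Y g f1"
      and f2: "norm_preserving_ext UNIV (+) (*\<^sub>R) norm Y g f2"
    show "f1 v = f2 v"
      using wU_extension_unique[OF wU' norm_attaining_quotient_zero[OF Y g],
          where f = "quot_lift {0} f1" and f' = "quot_lift {0} f2" and v = "coset {0} v"]
        f1 f2
      unfolding lift_ext quot_lift_zero_coset by blast
  qed
qed

lemma wU_iff_wU_quotients:
  fixes Y :: "'a::real_normed_vector set"
  assumes Y: "subspace Y"
  shows "wU UNIV (+) (*\<^sub>R) norm Y \<longleftrightarrow>
           (\<forall>Z. subspace Z \<and> closed Z \<and> Z \<subseteq> Y \<and> proximinal Z \<longrightarrow>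
              wU (quot_carrier Z UNIV) qadd (qscale Z) qnorm (quot_carrier Z Y))"
proof
  assume "wU UNIV (+) (*\<^sub>R) norm Y"
  then show "\<forall>Z. subspace Z \<and> closed Z \<and> Z \<subseteq> Y \<and> proximinal Z \<longrightarrow>
      wU (quot_carrier Z UNIV) qadd (qscale Z) qnorm (quot_carrier Z Y)"
    using wU_quotient[OF Y] by blast
next
  assume quotients: "\<forall>Z. subspace Z \<and> closed Z \<and> Z \<subseteq> Y \<and> proximinal Z \<longrightarrow>
      wU (quot_carrier Z UNIV) qadd (qscale Z) qnorm (quot_carrier Z Y)"
  have "wU (quot_carrier {0} UNIV) qadd (qscale {0}) qnorm (quot_carrier {0} Y)"
    using quotients[rule_format, of "{0}"] subspace_0[OF Y] proximinal_zero by simp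
  then show "wU UNIV (+) (*\<^sub>R) norm Y" by (rule wU_of_wU_quotient_zero[OF Y])
qed

theorem theorem2p1:
  fixes Y :: "'a::banach set"
  assumes "subspace Y" and "closed Y"
  shows "(wU UNIV (+) (*\<^sub>R) norm Y \<longleftrightarrow>
           (\<forall>Z. subspace Z \<and> closed Z \<and> Z \<subseteq> Y \<and> proximinal Z \<longrightarrow>
              wU (quot_carrier Z UNIV) qadd (qscale Z) qnorm (quot_carrier Z Y)))
       \<and> (wU UNIV (+) (*\<^sub>R) norm Y \<longleftrightarrow>
           (\<forall>f. bounded_linear f \<and> (\<exists>y\<in>Y. norm y = 1 \<and> f y = onorm f) \<longrightarrow>
              best_approx_dual (annihilator Y) f = {\<lambda>x. 0}))"
  using wU_iff_wU_quotients[OF \<open>subspace Y\<close>]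
    wU_iff_best_approx_annihilator_trivial[OF \<open>subspace Y\<close>]
  by blast

end
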